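(* Let $S$ be a commutative semiring, $T\subseteq S$ a multiplicatively closed set containing $1$, and $I$ an ideal of $S$ such that $(S,T,I)$ satisfies the maximal-disjointness hypothesis. Then extension $P\mapsto T^{-1}P$ and contraction $Q\mapsto Q^c$ give mutually inverse homeomorphisms $\mathrm{Spec}_z^{T,I}(S)\cong\mathrm{Spec}_z(T^{-1}S)$.
   Context: A semiring here is commutative with $0$ and $1$: $(S,+,0)$ and $(S,\cdot,1)$ are commutative monoids, multiplication distributes over addition, and $0s=0$. An ideal is a non-empty subset closed under addition and under multiplication by arbitrary elements; prime and maximal ideals are proper. $\mathrm{Max}(S)$ is the set of maximal ideals and $\mathcal M(a)=\{M\in\mathrm{Max}(S)\mid a\in M\}$. An ideal $K$ of a semiring is a $z$-ideal if $a\in K$ and $\mathcal M(a)=\mathcal M(b)$ imply $b\in K$ (hulls taken in that semiring). $\mathrm{Spec}_z(R)$ is the set of prime $z$-ideals of a semiring $R$, with closed sets $\{P\mid A\subseteq P\}$, $A\subseteq R$. $f:S\to T^{-1}S$, $a\mapsto a/1$, is the localization map ($a/s=b/t$ iff $uta=usb$ for some $u\in T$). For an ideal $J$ of $S$, $T^{-1}J=\{a/s\mid a\in J,\ s\in T\}$ is its extension; for an ideal $K$ of $T^{-1}S$, $K^c=f^{-1}(K)$ is its contraction. Put $\mathcal V_{\max}(I)=\{M\in\mathrm{Max}(S)\mid I\subseteq M\}$. The triple $(S,T,I)$ satisfies the maximal-disjointness hypothesis if extension and contraction give a bijection $\mathcal V_{\max}(I)\leftrightarrow\mathrm{Max}(T^{-1}S)$,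 $M\mapsto T^{-1}M$, and for every $M\in\mathcal V_{\max}(I)$ one has $M\cap T=\varnothing$ and $a/s\in T^{-1}M\Leftrightarrow a\in M$ for all $a\in S$, $s\in T$. An ideal $J$ of $S$ is an $I$-relative $z$-ideal if $a\in J$, $b\in S$ and $\mathcal M(a)\cap\mathcal V_{\max}(I)=\mathcal M(b)\cap\mathcal V_{\max}(I)$ imply $b\in J$. $\mathrm{Spec}_z^{T,I}(S)$ is the set of ideals $P$ of $S$ that are $I$-relative $z$-ideals, ordinary prime ideals, and satisfy $P\cap T=\varnothing$; it is topologized by the closed sets $V_{T,I}(A)=\{P\in\mathrm{Spec}_z^{T,I}(S)\mid A\subseteq P\}$, $A\subseteq S$. *)

theory Defs
  imports "HOL-Analysis.Abstract_Topology" "HOL-Algebra.Ring"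
begin

section \<open>Commutative semirings and their ideals\<close>

text \<open>The zero semiring is allowed: \<open>\<zero> = \<one>\<close> is not excluded.\<close>

locale csemiring = semiring R + comm_monoid R for R (structure)

text \<open>The library's ideals are those of rings (in particular additive subgroups), so the semiring
  notions are defined here.\<close>

definition semiring_ideal :: "'a set \<Rightarrow> ('a, 'm) ring_scheme \<Rightarrow> bool" where
  "semiring_ideal J R \<longleftrightarrow> J \<subseteq> carrier R \<and> J \<noteq> {} \<and>
     (\<forall>a\<in>J. \<forall>b\<in>J. a \<oplus>\<^bsub>R\<^esub> b \<in> J) \<and> (\<forall>r\<in>carrier R. \<forall>a\<in>J. r \<otimes>\<^bsub>R\<^esub> a \<in> J)"

definition semiring_prime :: "'a set \<Rightarrow> ('a, 'm) ring_scheme \<Rightarrow> bool" where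
  "semiring_prime P R \<longleftrightarrow> semiring_ideal P R \<and> P \<noteq> carrier R \<and>
     (\<forall>a\<in>carrier R. \<forall>b\<in>carrier R. a \<otimes>\<^bsub>R\<^esub> b \<in> P \<longrightarrow> a \<in> P \<or> b \<in> P)"

definition semiring_maximal :: "'a set \<Rightarrow> ('a, 'm) ring_scheme \<Rightarrow> bool" where
  "semiring_maximal M R \<longleftrightarrow> semiring_ideal M R \<and> M \<noteq> carrier R \<and>
     (\<forall>J. semiring_ideal J R \<and> M \<subseteq> J \<longrightarrow> J = M \<or> J = carrier R)"

definition Max_ideals :: "('a, 'm) ring_scheme \<Rightarrow> 'a set set" where
  "Max_ideals R = {M. semiring_maximal M R}"

definition Max_hull :: "('a, 'm) ring_scheme \<Rightarrow> 'a \<Rightarrow> 'a set set" where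
  "Max_hull R a = {M \<in> Max_ideals R. a \<in> M}"

definition V_max :: "('a, 'm) ring_scheme \<Rightarrow> 'a set \<Rightarrow> 'a set set" where
  "V_max R I = {M \<in> Max_ideals R. I \<subseteq> M}"

definition z_ideal :: "'a set \<Rightarrow> ('a, 'm) ring_scheme \<Rightarrow> bool" where
  "z_ideal K R \<longleftrightarrow> semiring_ideal K R \<and>
     (\<forall>a\<in>K. \<forall>b\<in>carrier R. Max_hull R a = Max_hull R b \<longrightarrow> b \<in> K)"

definition relative_z_ideal :: "'a set \<Rightarrow> 'a set \<Rightarrow> ('a, 'm) ring_scheme \<Rightarrow> bool" where
  "relative_z_ideal I J R \<longleftrightarrow> semiring_ideal J R \<and>
     (\<forall>a\<in>J. \<forall>b\<in>carrier R.
        Max_hull R a \<inter> V_max R I = Max_hull R b \<inter> V_max R I \<longrightarrow> b \<in> J)"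


section \<open>Localization\<close>

definition loc_rel :: "('a, 'm) ring_scheme \<Rightarrow> 'a set \<Rightarrow> (('a \<times> 'a) \<times> ('a \<times> 'a)) set" where
  "loc_rel S T = {((a, s), (b, t)) | a s b t.
     a \<in> carrier S \<and> s \<in> T \<and> b \<in> carrier S \<and> t \<in> T \<and>
     (\<exists>u\<in>T. u \<otimes>\<^bsub>S\<^esub> t \<otimes>\<^bsub>S\<^esub> a = u \<otimes>\<^bsub>S\<^esub> s \<otimes>\<^bsub>S\<^esub> b)}"

text \<open>The fraction \<open>a/s\<close>.\<close>

definition loc_frac :: "('a, 'm) ring_scheme \<Rightarrow> 'a set \<Rightarrow> 'a \<Rightarrow> 'a \<Rightarrow> ('a \<times> 'a) set" where
  "loc_frac S T a s = loc_rel S T `` {(a, s)}"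

text \<open>The operations on classes are unions over all representatives; by well-definedness
  (\<open>localization_mult\<close>, \<open>localization_add\<close> below) the sets united all coincide.\<close>

definition localization :: "('a, 'm) ring_scheme \<Rightarrow> 'a set \<Rightarrow> ('a \<times> 'a) set ring" where
  "localization S T =
     \<lparr>carrier = (carrier S \<times> T) // loc_rel S T,
      mult = (\<lambda>X Y. \<Union>(a, s)\<in>X. \<Union>(b, t)\<in>Y. loc_frac S T (a \<otimes>\<^bsub>S\<^esub> b) (s \<otimes>\<^bsub>S\<^esub> t)),
      one = loc_frac S T \<one>\<^bsub>S\<^esub> \<one>\<^bsub>S\<^esub>,
      zero = loc_frac S T \<zero>\<^bsub>S\<^esub> \<one>\<^bsub>S\<^esub>,
      add = (\<lambda>X Y. \<Union>(a, s)\<in>X. \<Union>(b, t)\<in>Y.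
               loc_frac S T ((t \<otimes>\<^bsub>S\<^esub> a) \<oplus>\<^bsub>S\<^esub> (s \<otimes>\<^bsub>S\<^esub> b)) (s \<otimes>\<^bsub>S\<^esub> t))\<rparr>"

definition extension :: "('a, 'm) ring_scheme \<Rightarrow> 'a set \<Rightarrow> 'a set \<Rightarrow> ('a \<times> 'a) set set" where
  "extension S T J = {loc_frac S T a s | a s. a \<in> J \<and> s \<in> T}"

definition contraction :: "('a, 'm) ring_scheme \<Rightarrow> 'a set \<Rightarrow> ('a \<times> 'a) set set \<Rightarrow> 'a set" where
  "contraction S T K = {a \<in> carrier S. loc_frac S T a \<one>\<^bsub>S\<^esub> \<in> K}"

definition maximal_disjointness :: "('a, 'm) ring_scheme \<Rightarrow> 'a set \<Rightarrow> 'a set \<Rightarrow> bool" where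
  "maximal_disjointness S T I \<longleftrightarrow>
     bij_betw (extension S T) (V_max S I) (Max_ideals (localization S T)) \<and>
     bij_betw (contraction S T) (Max_ideals (localization S T)) (V_max S I) \<and>
     (\<forall>M\<in>V_max S I. contraction S T (extension S T M) = M) \<and>
     (\<forall>N\<in>Max_ideals (localization S T). extension S T (contraction S T N) = N) \<and>
     (\<forall>M\<in>V_max S I. M \<inter> T = {} \<and>
        (\<forall>a\<in>carrier S. \<forall>s\<in>T. loc_frac S T a s \<in> extension S T M \<longleftrightarrow> a \<in> M))"


section \<open>The two spectra\<close>

definition Spec_z :: "('a, 'm) ring_scheme \<Rightarrow> 'a set set" where
  "Spec_z R = {P. semiring_prime P R \<and> z_ideal P R}"

definition Spec_z_rel :: "('a, 'm) ring_scheme \<Rightarrow> 'a set \<Rightarrow> 'a set \<Rightarrow> 'a set set" where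
  "Spec_z_rel S T I = {P. semiring_prime P S \<and> relative_z_ideal I P S \<and> P \<inter> T = {}}"

text \<open>The topology on a set \<open>X\<close> of prime ideals of \<open>R\<close> with closed sets \<open>{P \<in> X. A \<subseteq> P}\<close>, where
  \<open>A \<subseteq> R\<close>. Lemma \<open>closedin_hull_topology\<close> below shows that it is one.\<close>

definition hull_topology :: "('a, 'm) ring_scheme \<Rightarrow> 'a set set \<Rightarrow> 'a set topology" where
  "hull_topology R X =
     topology (\<lambda>U. \<exists>A. A \<subseteq> carrier R \<and> U = X - {P \<in> X. A \<subseteq> P})"

definition Spec_z_top :: "('a, 'm) ring_scheme \<Rightarrow> 'a set topology" where
  "Spec_z_top R = hull_topology R (Spec_z R)"

definition Spec_z_rel_top :: "('a, 'm) ring_scheme \<Rightarrow> 'a set \<Rightarrow> 'a set \<Rightarrow> 'a set topology" where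
  "Spec_z_rel_top S T I = hull_topology S (Spec_z_rel S T I)"


section \<open>Well-definedness\<close>

lemma semiring_prime_mult_iff:
  assumes "csemiring R" "semiring_prime P R" "a \<in> carrier R" "b \<in> carrier R"
  shows "a \<otimes>\<^bsub>R\<^esub> b \<in> P \<longleftrightarrow> a \<in> P \<or> b \<in> P"
proof -
  interpret csemiring R by fact
  have "r \<otimes>\<^bsub>R\<^esub> c \<in> P" if "r \<in> carrier R" "c \<in> P" for r c
    using assms(2) that unfolding semiring_prime_def semiring_ideal_def by blast
  from this[of a b] this[of b a] have "a \<in> P \<or> b \<in> P \<Longrightarrow> a \<otimes>\<^bsub>R\<^esub> b \<in> P"
    using assms(3,4) m_comm[of a b] by (elim disjE) simp_all
  then show ?thesis
    using assms(2-4) unfolding semiring_prime_def by blast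
qed

lemma istopology_hull:
  assumes R: "csemiring R" and X: "\<forall>P\<in>X. semiring_prime P R"
  shows "istopology (\<lambda>U. \<exists>A. A \<subseteq> carrier R \<and> U = X - {P \<in> X. A \<subseteq> P})"
  unfolding istopology_def
proof (intro conjI allI impI)
  interpret csemiring R by fact
  fix U V
  assume "\<exists>A. A \<subseteq> carrier R \<and> U = X - {P \<in> X. A \<subseteq> P}"
    and "\<exists>A. A \<subseteq> carrier R \<and> V = X - {P \<in> X. A \<subseteq> P}"
  then obtain A B where A: "A \<subseteq> carrier R" "U = X - {P \<in> X. A \<subseteq> P}"
    and B: "B \<subseteq> carrier R" "V = X - {P \<in> X. B \<subseteq> P}" by blast
  define C where "C = {a \<otimes>\<^bsub>R\<^esub> b | a b. a \<in> A \<and> b \<in> B}"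
  have "C \<subseteq> P \<longleftrightarrow> A \<subseteq> P \<or> B \<subseteq> P" if "P \<in> X" for P
  proof -
    have "a \<otimes>\<^bsub>R\<^esub> b \<in> P \<longleftrightarrow> a \<in> P \<or> b \<in> P" if "a \<in> A" "b \<in> B" for a b
      using semiring_prime_mult_iff[OF R bspec[OF X \<open>P \<in> X\<close>]] A(1) B(1) that by blast
    then show ?thesis unfolding C_def by blast
  qed
  then have "U \<inter> V = X - {P \<in> X. C \<subseteq> P}" unfolding A B by blast
  moreover have "C \<subseteq> carrier R" unfolding C_def using A(1) B(1) by auto
  ultimately show "\<exists>A. A \<subseteq> carrier R \<and> U \<inter> V = X - {P \<in> X. A \<subseteq> P}" by blast
next
  fix K :: "'a set set set"
  assume "\<forall>U\<in>K. \<exists>A. A \<subseteq> carrier R \<and> U = X - {P \<in> X. A \<subseteq> P}"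
  then obtain A where A: "\<And>U. U \<in> K \<Longrightarrow> A U \<subseteq> carrier R \<and> U = X - {P \<in> X. A U \<subseteq> P}"
    by metis
  have "\<Union>K = X - {P \<in> X. \<Union>(A ` K) \<subseteq> P}"
  proof
    show "\<Union>K \<subseteq> X - {P \<in> X. \<Union>(A ` K) \<subseteq> P}"
    proof
      fix P assume "P \<in> \<Union>K"
      then obtain U where "U \<in> K" "P \<in> U" by blast
      moreover from this have "P \<in> X - {P \<in> X. A U \<subseteq> P}" using A by blast
      ultimately show "P \<in> X - {P \<in> X. \<Union>(A ` K) \<subseteq> P}" by blast
    qed
    show "X - {P \<in> X. \<Union>(A ` K) \<subseteq> P} \<subseteq> \<Union>K"
    proof
      fix P assume "P \<in> X - {P \<in> X. \<Union>(A ` K) \<subseteq> P}"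
      then obtain U where "U \<in> K" "P \<in> X" "\<not> A U \<subseteq> P" by blast
      moreover from this have "P \<in> U" using A[of U] by blast
      ultimately show "P \<in> \<Union>K" by blast
    qed
  qed
  moreover have "\<Union>(A ` K) \<subseteq> carrier R" using A by blast
  ultimately show "\<exists>B. B \<subseteq> carrier R \<and> \<Union>K = X - {P \<in> X. B \<subseteq> P}" by blast
qed

lemma openin_hull_topology:
  assumes "csemiring R" "\<forall>P\<in>X. semiring_prime P R"
  shows "openin (hull_topology R X) U \<longleftrightarrow> (\<exists>A. A \<subseteq> carrier R \<and> U = X - {P \<in> X. A \<subseteq> P})"
  unfolding hull_topology_def using istopology_hull[OF assms] by simp

lemma topspace_hull_topology:
  assumes "csemiring R" "\<forall>P\<in>X. semiring_prime P R"
  shows "topspace (hull_topology R X) = X"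
proof
  show "topspace (hull_topology R X) \<subseteq> X"
    using openin_topspace[of "hull_topology R X"] unfolding openin_hull_topology[OF assms] by blast
  interpret csemiring R by fact
  have "\<one>\<^bsub>R\<^esub> \<notin> P" if "P \<in> X" for P
  proof
    assume "\<one>\<^bsub>R\<^esub> \<in> P"
    moreover have P: "semiring_prime P R" using assms(2) that by blast
    ultimately have "r \<otimes>\<^bsub>R\<^esub> \<one>\<^bsub>R\<^esub> \<in> P" if "r \<in> carrier R" for r
      using that unfolding semiring_prime_def semiring_ideal_def by blast
    then have "carrier R \<subseteq> P" by auto
    then show False
      using P unfolding semiring_prime_def semiring_ideal_def by blast
  qed
  then have "X = X - {P \<in> X. {\<one>\<^bsub>R\<^esub>} \<subseteq> P}" by blast
  moreover have "{\<one>\<^bsub>R\<^esub>} \<subseteq> carrier R" by simp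
  ultimately have "openin (hull_topology R X) X"
    unfolding openin_hull_topology[OF assms] by blast
  then show "X \<subseteq> topspace (hull_topology R X)" by (rule openin_subset)
qed

lemma closedin_hull_topology:
  assumes "csemiring R" "\<forall>P\<in>X. semiring_prime P R"
  shows "closedin (hull_topology R X) C \<longleftrightarrow> (\<exists>A. A \<subseteq> carrier R \<and> C = {P \<in> X. A \<subseteq> P})"
proof -
  have eq: "C \<subseteq> X \<and> X - C = X - {P \<in> X. A \<subseteq> P} \<longleftrightarrow> C = {P \<in> X. A \<subseteq> P}" for A by blast
  have "closedin (hull_topology R X) C \<longleftrightarrow>
      (\<exists>A. A \<subseteq> carrier R \<and> (C \<subseteq> X \<and> X - C = X - {P \<in> X. A \<subseteq> P}))"
    unfolding closedin_def topspace_hull_topology[OF assms] openin_hull_topology[OF assms]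
    by blast
  then show ?thesis unfolding eq .
qed

locale semiring_localization = csemiring S + submonoid T S for S (structure) and T
begin

lemma T_carr [simp]: "s \<in> T \<Longrightarrow> s \<in> carrier S"
  using subset by blast

lemma loc_rel_iff:
  "((a, s), (b, t)) \<in> loc_rel S T \<longleftrightarrow>
     a \<in> carrier S \<and> s \<in> T \<and> b \<in> carrier S \<and> t \<in> T \<and> (\<exists>u\<in>T. u \<otimes> t \<otimes> a = u \<otimes> s \<otimes> b)"
  unfolding loc_rel_def by blast

lemma equiv_loc_rel: "equiv (carrier S \<times> T) (loc_rel S T)"
proof (rule equivI)
  show "loc_rel S T \<subseteq> (carrier S \<times> T) \<times> (carrier S \<times> T)"
    unfolding loc_rel_def by blast
  show "refl_on (carrier S \<times> T) (loc_rel S T)"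
    unfolding refl_on_def using one_closed by (force simp: loc_rel_iff)
  show "sym (loc_rel S T)"
    unfolding sym_def by (force simp: loc_rel_iff)
  show "trans (loc_rel S T)"
  proof (rule transI, clarify)
    fix a s b t c r
    assume 1: "((a, s), (b, t)) \<in> loc_rel S T" and 2: "((b, t), (c, r)) \<in> loc_rel S T"
    then have [simp]: "a \<in> carrier S" "b \<in> carrier S" "c \<in> carrier S" "s \<in> T" "t \<in> T" "r \<in> T"
      by (auto simp: loc_rel_iff)
    from 1 obtain u where u: "u \<in> T" "u \<otimes> t \<otimes> a = u \<otimes> s \<otimes> b" by (auto simp: loc_rel_iff)
    from 2 obtain v where v: "v \<in> T" "v \<otimes> r \<otimes> b = v \<otimes> t \<otimes> c" by (auto simp: loc_rel_iff)
    have "(u \<otimes> v \<otimes> t) \<otimes> r \<otimes> a = v \<otimes> r \<otimes> (u \<otimes> t \<otimes> a)"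
      using u(1) v(1) by (simp add: m_ac)
    also have "\<dots> = u \<otimes> s \<otimes> (v \<otimes> r \<otimes> b)"
      unfolding u(2) using u(1) v(1) by (simp add: m_ac)
    also have "\<dots> = (u \<otimes> v \<otimes> t) \<otimes> s \<otimes> c"
      unfolding v(2) using u(1) v(1) by (simp add: m_ac)
    finally show "((a, s), (c, r)) \<in> loc_rel S T"
      using u(1) v(1) by (auto simp: loc_rel_iff intro!: bexI[of _ "u \<otimes> v \<otimes> t"])
  qed
qed

lemma loc_frac_eq_iff:
  assumes "a \<in> carrier S" "s \<in> T" "b \<in> carrier S" "t \<in> T"
  shows "loc_frac S T a s = loc_frac S T b t \<longleftrightarrow> (\<exists>u\<in>T. u \<otimes> t \<otimes> a = u \<otimes> s \<otimes> b)"
  using assms eq_equiv_class_iff[OF equiv_loc_rel, of "(a, s)" "(b, t)"]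
  unfolding loc_frac_def by (simp add: loc_rel_iff)

lemma loc_frac_eqI:
  assumes "a \<in> carrier S" "s \<in> T" "b \<in> carrier S" "t \<in> T" "t \<otimes> a = s \<otimes> b"
  shows "loc_frac S T a s = loc_frac S T b t"
  using assms by (subst loc_frac_eq_iff) (auto intro!: bexI[of _ \<one>])

lemma carrier_localization:
  "carrier (localization S T) = {loc_frac S T a s | a s. a \<in> carrier S \<and> s \<in> T}"
  unfolding localization_def loc_frac_def quotient_def by auto

lemma loc_frac_closed [simp]:
  "a \<in> carrier S \<Longrightarrow> s \<in> T \<Longrightarrow> loc_frac S T a s \<in> carrier (localization S T)"
  unfolding carrier_localization by blast

lemma mem_loc_fracD:
  assumes "(a', s') \<in> loc_frac S T a s"
  shows "a' \<in> carrier S" "s' \<in> T" "\<exists>u\<in>T. u \<otimes> s' \<otimes> a = u \<otimes> s \<otimes> a'"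
  using assms unfolding loc_frac_def by (auto simp: loc_rel_iff)

lemma mem_loc_frac_self: "a \<in> carrier S \<Longrightarrow> s \<in> T \<Longrightarrow> (a, s) \<in> loc_frac S T a s"
  unfolding loc_frac_def using equiv_class_self[OF equiv_loc_rel] by simp

lemma localization_mult:
  assumes [simp]: "a \<in> carrier S" "s \<in> T" "b \<in> carrier S" "t \<in> T"
  shows "loc_frac S T a s \<otimes>\<^bsub>localization S T\<^esub> loc_frac S T b t = loc_frac S T (a \<otimes> b) (s \<otimes> t)"
proof -
  have "loc_frac S T (a' \<otimes> b') (s' \<otimes> t') = loc_frac S T (a \<otimes> b) (s \<otimes> t)"
    if h: "(a', s') \<in> loc_frac S T a s" "(b', t') \<in> loc_frac S T b t" for a' s' b' t'
  proof -
    note [simp] = mem_loc_fracD(1,2)[OF h(1)] mem_loc_fracD(1,2)[OF h(2)]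
    obtain u where u: "u \<in> T" "u \<otimes> s' \<otimes> a = u \<otimes> s \<otimes> a'" using mem_loc_fracD(3)[OF h(1)] by blast
    obtain v where v: "v \<in> T" "v \<otimes> t' \<otimes> b = v \<otimes> t \<otimes> b'" using mem_loc_fracD(3)[OF h(2)] by blast
    have "(u \<otimes> v) \<otimes> (s \<otimes> t) \<otimes> (a' \<otimes> b') = (u \<otimes> s \<otimes> a') \<otimes> (v \<otimes> t \<otimes> b')"
      using u(1) v(1) by (simp add: m_ac)
    also have "\<dots> = (u \<otimes> v) \<otimes> (s' \<otimes> t') \<otimes> (a \<otimes> b)"
      unfolding u(2)[symmetric] v(2)[symmetric] using u(1) v(1) by (simp add: m_ac)
    finally show ?thesis using u(1) v(1) by (subst loc_frac_eq_iff) auto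
  qed
  then have "(\<Union>(a', s')\<in>loc_frac S T a s. \<Union>(b', t')\<in>loc_frac S T b t. loc_frac S T (a' \<otimes> b') (s' \<otimes> t'))
      = (\<Union>(a', s')\<in>loc_frac S T a s. \<Union>(b', t')\<in>loc_frac S T b t. loc_frac S T (a \<otimes> b) (s \<otimes> t))"
    by (intro SUP_cong refl) (auto intro!: SUP_cong)
  also have "\<dots> = loc_frac S T (a \<otimes> b) (s \<otimes> t)"
    using mem_loc_frac_self[of a s] mem_loc_frac_self[of b t] by auto
  finally show ?thesis by (simp add: localization_def)
qed

lemma localization_add:
  assumes [simp]: "a \<in> carrier S" "s \<in> T" "b \<in> carrier S" "t \<in> T"
  shows "loc_frac S T a s \<oplus>\<^bsub>localization S T\<^esub> loc_frac S T b t =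
    loc_frac S T ((t \<otimes> a) \<oplus> (s \<otimes> b)) (s \<otimes> t)"
proof -
  have "loc_frac S T ((t' \<otimes> a') \<oplus> (s' \<otimes> b')) (s' \<otimes> t') = loc_frac S T ((t \<otimes> a) \<oplus> (s \<otimes> b)) (s \<otimes> t)"
    if h: "(a', s') \<in> loc_frac S T a s" "(b', t') \<in> loc_frac S T b t" for a' s' b' t'
  proof -
    note [simp] = mem_loc_fracD(1,2)[OF h(1)] mem_loc_fracD(1,2)[OF h(2)]
    obtain u where u: "u \<in> T" "u \<otimes> s' \<otimes> a = u \<otimes> s \<otimes> a'" using mem_loc_fracD(3)[OF h(1)] by blast
    obtain v where v: "v \<in> T" "v \<otimes> t' \<otimes> b = v \<otimes> t \<otimes> b'" using mem_loc_fracD(3)[OF h(2)] by blast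
    have "(u \<otimes> v) \<otimes> (s \<otimes> t) \<otimes> ((t' \<otimes> a') \<oplus> (s' \<otimes> b')) =
        (v \<otimes> t \<otimes> t') \<otimes> (u \<otimes> s \<otimes> a') \<oplus> (u \<otimes> s \<otimes> s') \<otimes> (v \<otimes> t \<otimes> b')"
      using u(1) v(1) by (simp add: m_ac r_distr)
    also have "\<dots> = (u \<otimes> v) \<otimes> (s' \<otimes> t') \<otimes> ((t \<otimes> a) \<oplus> (s \<otimes> b))"
      unfolding u(2)[symmetric] v(2)[symmetric] using u(1) v(1) by (simp add: m_ac r_distr)
    finally show ?thesis using u(1) v(1) by (subst loc_frac_eq_iff) auto
  qed
  then have "(\<Union>(a', s')\<in>loc_frac S T a s. \<Union>(b', t')\<in>loc_frac S T b t. loc_frac S T ((t' \<otimes> a') \<oplus> (s' \<otimes> b')) (s' \<otimes> t'))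
      = (\<Union>(a', s')\<in>loc_frac S T a s. \<Union>(b', t')\<in>loc_frac S T b t. loc_frac S T ((t \<otimes> a) \<oplus> (s \<otimes> b)) (s \<otimes> t))"
    by (intro SUP_cong refl) (auto intro!: SUP_cong)
  also have "\<dots> = loc_frac S T ((t \<otimes> a) \<oplus> (s \<otimes> b)) (s \<otimes> t)"
    using mem_loc_frac_self[of a s] mem_loc_frac_self[of b t] by auto
  finally show ?thesis by (simp add: localization_def)
qed

lemma localization_one: "\<one>\<^bsub>localization S T\<^esub> = loc_frac S T \<one> \<one>"
  by (simp add: localization_def)

lemma localization_zero: "\<zero>\<^bsub>localization S T\<^esub> = loc_frac S T \<zero> \<one>"
  by (simp add: localization_def)

lemma csemiring_localization: "csemiring (localization S T)"
proof -
  let ?L = "localization S T"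
  have ex: "\<exists>a s. a \<in> carrier S \<and> s \<in> T \<and> x = loc_frac S T a s" if "x \<in> carrier ?L" for x
    using that unfolding carrier_localization by blast
  note loc = localization_mult localization_add localization_one localization_zero
  have m: "comm_monoid ?L"
  proof (rule comm_monoidI)
    fix x y z assume "x \<in> carrier ?L" "y \<in> carrier ?L" "z \<in> carrier ?L"
    then show "x \<otimes>\<^bsub>?L\<^esub> y \<otimes>\<^bsub>?L\<^esub> z = x \<otimes>\<^bsub>?L\<^esub> (y \<otimes>\<^bsub>?L\<^esub> z)"
      by (auto dest!: ex simp: loc m_ac)
  qed (auto dest!: ex simp: loc m_comm)
  have a: "comm_monoid (add_monoid ?L)"
  proof (rule comm_monoidI, simp_all)
    fix x y assume "x \<in> carrier ?L" "y \<in> carrier ?L"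
    then show "x \<oplus>\<^bsub>?L\<^esub> y \<in> carrier ?L" "x \<oplus>\<^bsub>?L\<^esub> y = y \<oplus>\<^bsub>?L\<^esub> x"
      by (auto dest!: ex simp: loc m_ac a_ac)
    fix z assume "z \<in> carrier ?L"
    then show "x \<oplus>\<^bsub>?L\<^esub> y \<oplus>\<^bsub>?L\<^esub> z = x \<oplus>\<^bsub>?L\<^esub> (y \<oplus>\<^bsub>?L\<^esub> z)"
      using \<open>x \<in> carrier ?L\<close> \<open>y \<in> carrier ?L\<close>
      by (auto dest!: ex simp: loc m_ac a_ac r_distr)
  qed (auto dest!: ex simp: loc)
  have d: "x \<otimes>\<^bsub>?L\<^esub> (y \<oplus>\<^bsub>?L\<^esub> z) = x \<otimes>\<^bsub>?L\<^esub> y \<oplus>\<^bsub>?L\<^esub> x \<otimes>\<^bsub>?L\<^esub> z"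
    if h: "x \<in> carrier ?L" "y \<in> carrier ?L" "z \<in> carrier ?L" for x y z
  proof -
    obtain a s b t c r where [simp]:
      "a \<in> carrier S" "s \<in> T" "b \<in> carrier S" "t \<in> T" "c \<in> carrier S" "r \<in> T"
      and xyz: "x = loc_frac S T a s" "y = loc_frac S T b t" "z = loc_frac S T c r"
      using ex[OF h(1)] ex[OF h(2)] ex[OF h(3)] by blast
    show ?thesis
      unfolding xyz by (simp add: loc, rule loc_frac_eqI) (simp_all add: m_ac r_distr)
  qed
  have n: "x \<otimes>\<^bsub>?L\<^esub> \<zero>\<^bsub>?L\<^esub> = \<zero>\<^bsub>?L\<^esub>" if c: "x \<in> carrier ?L" for x
  proof -
    obtain a s where [simp]: "a \<in> carrier S" "s \<in> T" and x: "x = loc_frac S T a s"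
      using ex[OF c] by blast
    show ?thesis
      unfolding x by (simp add: loc, rule loc_frac_eqI) simp_all
  qed
  interpret L: comm_monoid ?L by (rule m)
  interpret A: abelian_monoid ?L by (intro abelian_monoid.intro a)
  show ?thesis
  proof unfold_locales
    fix x y z assume c: "x \<in> carrier ?L" "y \<in> carrier ?L" "z \<in> carrier ?L"
    show "z \<otimes>\<^bsub>?L\<^esub> (x \<oplus>\<^bsub>?L\<^esub> y) = z \<otimes>\<^bsub>?L\<^esub> x \<oplus>\<^bsub>?L\<^esub> z \<otimes>\<^bsub>?L\<^esub> y"
      using d c by simp
    then show "(x \<oplus>\<^bsub>?L\<^esub> y) \<otimes>\<^bsub>?L\<^esub> z = x \<otimes>\<^bsub>?L\<^esub> z \<oplus>\<^bsub>?L\<^esub> y \<otimes>\<^bsub>?L\<^esub> z"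
      using c L.m_comm[of z] A.a_closed by simp
  next
    fix x assume c: "x \<in> carrier ?L"
    show "x \<otimes>\<^bsub>?L\<^esub> \<zero>\<^bsub>?L\<^esub> = \<zero>\<^bsub>?L\<^esub>" using n c by simp
    then show "\<zero>\<^bsub>?L\<^esub> \<otimes>\<^bsub>?L\<^esub> x = \<zero>\<^bsub>?L\<^esub>" using c L.m_comm[of x] A.zero_closed by simp
  qed
qed

end

end

theory Submission
  imports Defs
begin

text \<open>For a prime \<open>P\<close> disjoint from \<open>T\<close>, and for every ideal of the localization, membership of a
  fraction depends only on its numerator. Together with the correspondence of maximal ideals this
  turns an equality of hulls of two fractions into an equality of the hulls of their numerators
  relative to \<open>I\<close>, so each of the two \<open>z\<close>-conditions transfers to the other.\<close>

section \<open>Continuity between hull topologies\<close>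

text \<open>Closed sets are hulls, so \<open>h\<close> is continuous once the condition
  \<open>A \<subseteq> h P\<close> can be rewritten as \<open>B \<subseteq> P\<close> with a
  \<open>B\<close> that does not depend on \<open>P\<close>. Both continuity claims thereby become
  translations of containments.\<close>

lemma continuous_map_hull_topology:
  assumes "csemiring R" "\<forall>P\<in>X. semiring_prime P R"
    and "csemiring R'" "\<forall>P\<in>Y. semiring_prime P R'"
    and h: "\<And>P. P \<in> X \<Longrightarrow> h P \<in> Y"
    and pre: "\<And>A. A \<subseteq> carrier R' \<Longrightarrow> \<exists>B. B \<subseteq> carrier R \<and> (\<forall>P\<in>X. A \<subseteq> h P \<longleftrightarrow> B \<subseteq> P)"
  shows "continuous_map (hull_topology R X) (hull_topology R' Y) h"
  unfolding continuous_map_closedin topspace_hull_topology[OF assms(1,2)]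
    topspace_hull_topology[OF assms(3,4)] closedin_hull_topology[OF assms(1,2)]
    closedin_hull_topology[OF assms(3,4)]
proof (intro conjI allI impI funcsetI)
  fix C assume "\<exists>A. A \<subseteq> carrier R' \<and> C = {P \<in> Y. A \<subseteq> P}"
  then obtain A where A: "A \<subseteq> carrier R'" "C = {P \<in> Y. A \<subseteq> P}" by blast
  obtain B where B: "B \<subseteq> carrier R" "\<forall>P\<in>X. A \<subseteq> h P \<longleftrightarrow> B \<subseteq> P" using pre[OF A(1)] by blast
  have "{P \<in> X. h P \<in> C} = {P \<in> X. B \<subseteq> P}" using A(2) B(2) h by blast
  with B(1) show "\<exists>B. B \<subseteq> carrier R \<and> {P \<in> X. h P \<in> C} = {P \<in> X. B \<subseteq> P}" by blast
qed (simp add: h)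

lemma semiring_ideal_carrierD: "semiring_ideal J R \<Longrightarrow> a \<in> J \<Longrightarrow> a \<in> carrier R"
  unfolding semiring_ideal_def by blast

lemma semiring_ideal_add: "semiring_ideal J R \<Longrightarrow> a \<in> J \<Longrightarrow> b \<in> J \<Longrightarrow> a \<oplus>\<^bsub>R\<^esub> b \<in> J"
  unfolding semiring_ideal_def by blast

lemma semiring_ideal_mult: "semiring_ideal J R \<Longrightarrow> r \<in> carrier R \<Longrightarrow> a \<in> J \<Longrightarrow> r \<otimes>\<^bsub>R\<^esub> a \<in> J"
  unfolding semiring_ideal_def by blast

lemma (in csemiring) one_mem_semiring_ideal:
  assumes "semiring_ideal J R" "\<one> \<in> J"
  shows "J = carrier R"
proof
  show "carrier R \<subseteq> J" using semiring_ideal_mult[OF assms(1) _ assms(2)] by force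
qed (use semiring_ideal_carrierD[OF assms(1)] in blast)

lemma semiring_prime_ideal: "semiring_prime P R \<Longrightarrow> semiring_ideal P R"
  unfolding semiring_prime_def by blast

section \<open>Extension and contraction of ideals and primes\<close>

context semiring_localization
begin

abbreviation "L \<equiv> localization S T"

lemma carrier_localizationE:
  assumes "x \<in> carrier L"
  obtains a s where "a \<in> carrier S" "s \<in> T" "x = loc_frac S T a s"
  using assms unfolding carrier_localization by blast

lemma extensionE:
  assumes "x \<in> extension S T J"
  obtains a s where "a \<in> J" "s \<in> T" "x = loc_frac S T a s"
  using assms unfolding extension_def by blast

text \<open>The fractions a/s and a/1 differ by the unit s/1, whose inverse is 1/s, and an ideal
  absorbs multiplication by either.\<close>

lemma loc_frac_mem_ideal_iff:
  assumes Q: "semiring_ideal Q L" and [simp]: "a \<in> carrier S" "s \<in> T"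
  shows "loc_frac S T a s \<in> Q \<longleftrightarrow> loc_frac S T a \<one> \<in> Q"
proof
  assume "loc_frac S T a s \<in> Q"
  then have "loc_frac S T s \<one> \<otimes>\<^bsub>L\<^esub> loc_frac S T a s \<in> Q"
    by (intro semiring_ideal_mult[OF Q]) auto
  moreover have "loc_frac S T s \<one> \<otimes>\<^bsub>L\<^esub> loc_frac S T a s = loc_frac S T a \<one>"
    by (simp add: localization_mult, rule loc_frac_eqI) (simp_all add: m_ac)
  ultimately show "loc_frac S T a \<one> \<in> Q" by simp
next
  assume "loc_frac S T a \<one> \<in> Q"
  then have "loc_frac S T \<one> s \<otimes>\<^bsub>L\<^esub> loc_frac S T a \<one> \<in> Q"
    by (intro semiring_ideal_mult[OF Q]) auto
  then show "loc_frac S T a s \<in> Q" by (simp add: localization_mult)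
qed

text \<open>If a/s lies in \<open>Q\<close>, then so does a/1, hence the numerator a is already in
  the contraction; the converse inclusion reads the same equivalence backwards.\<close>

lemma extension_contraction:
  assumes Q: "semiring_ideal Q L"
  shows "extension S T (contraction S T Q) = Q"
proof
  show "extension S T (contraction S T Q) \<subseteq> Q"
    unfolding extension_def contraction_def using loc_frac_mem_ideal_iff[OF Q] by blast
  show "Q \<subseteq> extension S T (contraction S T Q)"
  proof
    fix x assume x: "x \<in> Q"
    obtain a s where a: "a \<in> carrier S" "s \<in> T" "x = loc_frac S T a s"
      using semiring_ideal_carrierD[OF Q x] by (rule carrier_localizationE)
    then have "a \<in> contraction S T Q"
      using x loc_frac_mem_ideal_iff[OF Q a(1,2)] by (simp add: contraction_def)
    with a show "x \<in> extension S T (contraction S T Q)" unfolding extension_def by blast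
  qed
qed

lemma semiring_ideal_extension:
  assumes J: "semiring_ideal J S"
  shows "semiring_ideal (extension S T J) L"
proof -
  note J_carr [simp] = semiring_ideal_carrierD[OF J]
  have mem: "loc_frac S T a s \<in> extension S T J" if "a \<in> J" "s \<in> T" for a s
    using that unfolding extension_def by blast
  have "x \<oplus>\<^bsub>L\<^esub> y \<in> extension S T J" if "x \<in> extension S T J" "y \<in> extension S T J" for x y
    using that
    by (auto elim!: extensionE simp: localization_add
        intro!: mem semiring_ideal_add[OF J] semiring_ideal_mult[OF J])
  moreover have "r \<otimes>\<^bsub>L\<^esub> x \<in> extension S T J" if "r \<in> carrier L" "x \<in> extension S T J" for r x
    using that
    by (auto elim!: extensionE carrier_localizationE simp: localization_mult
        intro!: mem semiring_ideal_mult[OF J])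
  moreover obtain a where "a \<in> J" using J unfolding semiring_ideal_def by blast
  then have "extension S T J \<noteq> {}" using mem[of a \<one>] by auto
  moreover have "extension S T J \<subseteq> carrier L" by (auto elim!: extensionE)
  ultimately show ?thesis unfolding semiring_ideal_def by blast
qed

text \<open>An equation a/s = b/t with b in \<open>P\<close> yields u, t in \<open>T\<close> with
  uta = usb in \<open>P\<close>. As ut lies in \<open>T\<close>, it is outside \<open>P\<close>, and
  primality leaves a in \<open>P\<close>.\<close>

lemma loc_frac_mem_extension_iff:
  assumes P: "semiring_prime P S" "P \<inter> T = {}" and [simp]: "a \<in> carrier S" "s \<in> T"
  shows "loc_frac S T a s \<in> extension S T P \<longleftrightarrow> a \<in> P"
proof
  note I = semiring_prime_ideal[OF P(1)]
  assume "loc_frac S T a s \<in> extension S T P"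
  then obtain b t where b: "b \<in> P" "t \<in> T" "loc_frac S T a s = loc_frac S T b t"
    by (rule extensionE)
  note [simp] = semiring_ideal_carrierD[OF I b(1)] b(2)
  obtain u where u: "u \<in> T" "u \<otimes> t \<otimes> a = u \<otimes> s \<otimes> b" using b(3) by (auto simp: loc_frac_eq_iff)
  have "u \<otimes> t \<otimes> a \<in> P" unfolding u(2) using u(1) b(1) by (intro semiring_ideal_mult[OF I]) auto
  moreover have "u \<otimes> t \<in> T" using u(1) by simp
  ultimately show "a \<in> P"
    using P semiring_prime_mult_iff[OF csemiring_axioms P(1), of "u \<otimes> t" a] by auto
next
  assume "a \<in> P" then show "loc_frac S T a s \<in> extension S T P"
    unfolding extension_def using assms(4) by blast
qed

lemma contraction_extension:
  assumes "semiring_prime P S" "P \<inter> T = {}"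
  shows "contraction S T (extension S T P) = P"
  using loc_frac_mem_extension_iff[OF assms] semiring_prime_ideal[OF assms(1)]
  unfolding contraction_def semiring_ideal_def by auto

lemma semiring_prime_extension:
  assumes P: "semiring_prime P S" "P \<inter> T = {}"
  shows "semiring_prime (extension S T P) L"
  unfolding semiring_prime_def
proof (intro conjI ballI impI)
  note frac = loc_frac_mem_extension_iff[OF P]
  show "semiring_ideal (extension S T P) L"
    by (rule semiring_ideal_extension[OF semiring_prime_ideal[OF P(1)]])
  \<comment> \<open>Properness: 1 belongs to \<open>T\<close>, so disjointness keeps it out of
    \<open>P\<close>, and then 1/1 is missing from the extension.\<close>
  have "\<one> \<notin> P" using P(2) one_closed by blast
  then have "loc_frac S T \<one> \<one> \<notin> extension S T P" by (simp add: frac)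
  then show "extension S T P \<noteq> carrier L" by force
  fix x y assume "x \<in> carrier L" "y \<in> carrier L" "x \<otimes>\<^bsub>L\<^esub> y \<in> extension S T P"
  then show "x \<in> extension S T P \<or> y \<in> extension S T P"
    using P(1)
    by (auto elim!: carrier_localizationE simp: localization_mult frac semiring_prime_def)
qed

text \<open>An element s of \<open>T\<close> becomes the unit s/1, which no proper ideal can
  contain.\<close>

lemma contraction_disjoint:
  assumes Q: "semiring_ideal Q L" "Q \<noteq> carrier L"
  shows "contraction S T Q \<inter> T = {}"
proof (rule ccontr)
  interpret L: csemiring L by (rule csemiring_localization)
  assume "contraction S T Q \<inter> T \<noteq> {}"
  then obtain s where s: "s \<in> T" "loc_frac S T s \<one> \<in> Q" unfolding contraction_def by blast
  \<comment> \<open>Changing the denominator from 1 to s preserves membership and turns s/1 into the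
    identity s/s.\<close>
  then have "loc_frac S T s s \<in> Q" using loc_frac_mem_ideal_iff[OF Q(1), of s s] by simp
  moreover have "loc_frac S T s s = \<one>\<^bsub>L\<^esub>"
    unfolding localization_one using s(1) by (intro loc_frac_eqI) auto
  ultimately show False using L.one_mem_semiring_ideal[OF Q(1)] Q(2) by simp
qed

lemma semiring_ideal_contraction:
  assumes Q: "semiring_ideal Q L"
  shows "semiring_ideal (contraction S T Q) S"
proof -
  have "a \<oplus> b \<in> contraction S T Q" if "a \<in> contraction S T Q" "b \<in> contraction S T Q" for a b
    using that semiring_ideal_add[OF Q, of "loc_frac S T a \<one>" "loc_frac S T b \<one>"]
    by (simp add: contraction_def localization_add)
  moreover have "r \<otimes> a \<in> contraction S T Q" if "r \<in> carrier S" "a \<in> contraction S T Q" for r a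
    using that semiring_ideal_mult[OF Q, of "loc_frac S T r \<one>" "loc_frac S T a \<one>"]
    by (simp add: contraction_def localization_mult)
  \<comment> \<open>\<open>Q\<close> is recovered by extending its contraction, so an empty
    contraction would force \<open>Q\<close> to be empty.\<close>
  moreover have "contraction S T Q \<noteq> {}"
  proof
    assume "contraction S T Q = {}"
    then have "Q = {}" using extension_contraction[OF Q] by (simp add: extension_def)
    then show False using Q unfolding semiring_ideal_def by blast
  qed
  ultimately show ?thesis unfolding semiring_ideal_def by (auto simp: contraction_def)
qed

lemma semiring_prime_contraction:
  assumes Q: "semiring_prime Q L"
  shows "semiring_prime (contraction S T Q) S"
  unfolding semiring_prime_def
proof (intro conjI ballI impI)
  note I = semiring_prime_ideal[OF Q]
  show "semiring_ideal (contraction S T Q) S" by (rule semiring_ideal_contraction[OF I])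
  have "contraction S T Q \<inter> T = {}"
    using Q contraction_disjoint unfolding semiring_prime_def by blast
  then show "contraction S T Q \<noteq> carrier S" using one_closed T_carr by blast
  fix a b assume "a \<in> carrier S" "b \<in> carrier S" "a \<otimes> b \<in> contraction S T Q"
  then show "a \<in> contraction S T Q \<or> b \<in> contraction S T Q"
    using semiring_prime_mult_iff[OF csemiring_localization Q, of "loc_frac S T a \<one>" "loc_frac S T b \<one>"]
    by (simp add: contraction_def localization_mult)
qed

section \<open>Transfer of hulls and of the two z-conditions\<close>

text \<open>The hypothesis makes the maximal ideals of \<open>L\<close> exactly the extensions of
  members of \<open>V_max S I\<close>, and its membership clause selects those whose preimage
  contains the numerator. The denominator drops out.\<close>

lemma Max_hull_loc_frac:
  assumes I: "maximal_disjointness S T I" and a: "a \<in> carrier S" "s \<in> T"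
  shows "Max_hull L (loc_frac S T a s) = extension S T ` (Max_hull S a \<inter> V_max S I)"
proof -
  have Max: "Max_ideals L = extension S T ` V_max S I"
    using I unfolding maximal_disjointness_def bij_betw_def by simp
  have frac: "loc_frac S T a s \<in> extension S T M \<longleftrightarrow> a \<in> M" if "M \<in> V_max S I" for M
    using I a that unfolding maximal_disjointness_def by simp
  have "Max_hull S a \<inter> V_max S I = {M \<in> V_max S I. a \<in> M}"
    unfolding Max_hull_def V_max_def by blast
  also have "\<dots> = {M \<in> V_max S I. loc_frac S T a s \<in> extension S T M}"
    using frac by (intro Collect_cong) auto
  finally show ?thesis unfolding Max_hull_def[of L] Max by blast
qed

text \<open>Both hulls are images of subsets of \<open>V_max S I\<close> under extension, which is
  injective there, so the images agree exactly when the subsets do.\<close>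

lemma Max_hull_loc_frac_eq_iff:
  assumes I: "maximal_disjointness S T I"
    and "a \<in> carrier S" "s \<in> T" "b \<in> carrier S" "t \<in> T"
  shows "Max_hull L (loc_frac S T a s) = Max_hull L (loc_frac S T b t) \<longleftrightarrow>
    Max_hull S a \<inter> V_max S I = Max_hull S b \<inter> V_max S I"
proof -
  have "inj_on (extension S T) (V_max S I)"
    using I unfolding maximal_disjointness_def bij_betw_def by simp
  then show ?thesis
    using assms(2-5) by (simp add: Max_hull_loc_frac[OF I] inj_on_image_eq_iff)
qed

lemma extension_mem_Spec_z:
  assumes I: "maximal_disjointness S T I" and P: "P \<in> Spec_z_rel S T I"
  shows "extension S T P \<in> Spec_z L"
proof -
  have prime: "semiring_prime P S" "P \<inter> T = {}" and rel: "relative_z_ideal I P S"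
    using P unfolding Spec_z_rel_def by auto
  note frac = loc_frac_mem_extension_iff[OF prime]
  have "y \<in> extension S T P"
    if h: "x \<in> extension S T P" "y \<in> carrier L" "Max_hull L x = Max_hull L y" for x y
  proof -
    \<comment> \<open>The representative of \<open>x\<close> is chosen with numerator in
      \<open>P\<close>; for \<open>y\<close> any representative will do, as its numerator is then
      forced into \<open>P\<close> by the relative z-condition.\<close>
    obtain a s where a: "a \<in> P" "s \<in> T" "x = loc_frac S T a s" using h(1) by (rule extensionE)
    obtain b t where b: "b \<in> carrier S" "t \<in> T" "y = loc_frac S T b t"
      using h(2) by (rule carrier_localizationE)
    have "a \<in> carrier S" using semiring_prime_ideal[OF prime(1)] a(1) by (rule semiring_ideal_carrierD)
    then have "Max_hull S a \<inter> V_max S I = Max_hull S b \<inter> V_max S I"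
      using h(3) a b Max_hull_loc_frac_eq_iff[OF I] by simp
    then have "b \<in> P" using rel a(1) b(1) unfolding relative_z_ideal_def by blast
    then show ?thesis using b frac by simp
  qed
  then show ?thesis
    using semiring_prime_extension[OF prime] semiring_prime_ideal
    unfolding Spec_z_def z_ideal_def by blast
qed

lemma contraction_mem_Spec_z_rel:
  assumes I: "maximal_disjointness S T I" and Q: "Q \<in> Spec_z L"
  shows "contraction S T Q \<in> Spec_z_rel S T I"
proof -
  have prime: "semiring_prime Q L" and z: "z_ideal Q L"
    using Q unfolding Spec_z_def by auto
  have "b \<in> contraction S T Q"
    if h: "a \<in> contraction S T Q" "b \<in> carrier S"
      "Max_hull S a \<inter> V_max S I = Max_hull S b \<inter> V_max S I" for a b
  proof -
    have a: "a \<in> carrier S" "loc_frac S T a \<one> \<in> Q" using h(1) unfolding contraction_def by auto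
    \<comment> \<open>The relative hull equality is carried to a/1 and b/1, where the z-condition on
      \<open>Q\<close> applies.\<close>
    have "Max_hull L (loc_frac S T a \<one>) = Max_hull L (loc_frac S T b \<one>)"
      using h a Max_hull_loc_frac_eq_iff[OF I] by simp
    then have "loc_frac S T b \<one> \<in> Q"
      using z a(2) h(2) unfolding z_ideal_def by simp
    then show ?thesis using h(2) unfolding contraction_def by simp
  qed
  moreover have "contraction S T Q \<inter> T = {}"
    using prime contraction_disjoint unfolding semiring_prime_def by blast
  ultimately show ?thesis
    using semiring_prime_contraction[OF prime] semiring_prime_ideal
    unfolding Spec_z_rel_def relative_z_ideal_def by blast
qed

end

section \<open>The homeomorphism\<close>

theorem theorem7p6:
  fixes S :: "('a, 'm) ring_scheme" and T I :: "'a set"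
  assumes "csemiring S"
    and "submonoid T S"
    and "semiring_ideal I S"
    and "maximal_disjointness S T I"
  shows "homeomorphic_maps (Spec_z_rel_top S T I) (Spec_z_top (localization S T))
           (extension S T) (contraction S T)"
proof -
  interpret semiring_localization S T
    using assms(1,2) by (rule semiring_localization.intro)
  let ?X = "Spec_z_rel S T I" and ?Y = "Spec_z L"
  have X: "\<forall>P\<in>?X. semiring_prime P S" and Y: "\<forall>Q\<in>?Y. semiring_prime Q L"
    unfolding Spec_z_rel_def Spec_z_def by auto
  have "continuous_map (hull_topology S ?X) (hull_topology L ?Y) (extension S T)"
  proof (rule continuous_map_hull_topology[OF assms(1) X csemiring_localization Y
        extension_mem_Spec_z[OF assms(4)]])
    fix A assume A: "A \<subseteq> carrier L"
    \<comment> \<open>\<open>?B\<close> collects every numerator of every fraction in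
      \<open>A\<close>. Membership in the extension of a prime of \<open>?X\<close> depends only on
      the numerator, so this one set serves all such primes.\<close>
    let ?B = "{a \<in> carrier S. \<exists>s\<in>T. loc_frac S T a s \<in> A}"
    have "A \<subseteq> extension S T P \<longleftrightarrow> ?B \<subseteq> P" if "P \<in> ?X" for P
    proof -
      have P: "semiring_prime P S" "P \<inter> T = {}" using that unfolding Spec_z_rel_def by auto
      note frac = loc_frac_mem_extension_iff[OF P]
      show ?thesis
      proof
        assume "A \<subseteq> extension S T P" then show "?B \<subseteq> P" using frac by blast
      next
        assume B: "?B \<subseteq> P"
        show "A \<subseteq> extension S T P"
        proof
          fix x assume "x \<in> A"
          then obtain a s where a: "a \<in> carrier S" "s \<in> T" "x = loc_frac S T a s"
            using A carrier_localizationE[of x] by blast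
          with \<open>x \<in> A\<close> B have "a \<in> P" by blast
          with a frac show "x \<in> extension S T P" by simp
        qed
      qed
    qed
    then show "\<exists>B. B \<subseteq> carrier S \<and> (\<forall>P\<in>?X. A \<subseteq> extension S T P \<longleftrightarrow> B \<subseteq> P)"
      by (intro exI[of _ ?B]) blast
  qed
  moreover have "continuous_map (hull_topology L ?Y) (hull_topology S ?X) (contraction S T)"
  proof (rule continuous_map_hull_topology[OF csemiring_localization Y assms(1) X
        contraction_mem_Spec_z_rel[OF assms(4)]])
    fix A assume A: "A \<subseteq> carrier S"
    \<comment> \<open>Contraction is the preimage under the localization map, so the matching set is
      the image of \<open>A\<close> under that map.\<close>
    then have "A \<subseteq> contraction S T Q \<longleftrightarrow> (\<lambda>a. loc_frac S T a \<one>\<^bsub>S\<^esub>) ` A \<subseteq> Q" for Q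
      unfolding contraction_def by blast
    moreover have "(\<lambda>a. loc_frac S T a \<one>\<^bsub>S\<^esub>) ` A \<subseteq> carrier L" using A by auto
    ultimately show "\<exists>B. B \<subseteq> carrier L \<and> (\<forall>Q\<in>?Y. A \<subseteq> contraction S T Q \<longleftrightarrow> B \<subseteq> Q)"
      by (intro exI[of _ "(\<lambda>a. loc_frac S T a \<one>\<^bsub>S\<^esub>) ` A"] conjI ballI)
  qed
  moreover have "contraction S T (extension S T P) = P" if "P \<in> ?X" for P
    using that contraction_extension unfolding Spec_z_rel_def by blast
  moreover have "extension S T (contraction S T Q) = Q" if "Q \<in> ?Y" for Q
    using that Y extension_contraction semiring_prime_ideal by blast
  ultimately show ?thesis
    unfolding homeomorphic_maps_def Spec_z_rel_top_def Spec_z_top_def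
      topspace_hull_topology[OF assms(1) X] topspace_hull_topology[OF csemiring_localization Y]
    by (intro conjI ballI)
qed

end
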